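(* Let $X$ be a locally compact Polish space and let $\mathcal P$ denote the Borel set of pairs $(A,B)\in F(X)\times F(X)$ such that $A\cap B=\varnothing$. For each such pair there exists a continuous map $f:X\to[0,1]$ such that $f$ is constantly $0$ on $A$ and constantly $1$ on $B$; moreover $f$ may be taken to depend in a Borel way on $(A,B)$, i.e. there is a Borel function $\mathcal P\to\mathrm{Map}(X,[0,1])$, $(A,B)\mapsto f$, such that $f$ has these properties for every $(A,B)\in\mathcal P$.
   Context: $F(X)$ is the set of closed subsets of $X$ with the Fell topology, whose basic open sets are $\{F\in F(X):F\cap K=\varnothing,\ F\cap U_1\neq\varnothing,\dots,F\cap U_n\ne\varnothing\}$ for $K\subseteq X$ compact and $U_1,\dots,U_n\subseteq X$ open; it is a Polish space. $\mathrm{Map}(X,[0,1])$ is the Polish space of continuous functions with the compact-open topology. *)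

theory Defs
  imports "HOL-Analysis.Analysis"
begin

definition Polish_space :: "'a topology \<Rightarrow> bool"
  where "Polish_space X \<longleftrightarrow> separable_space X \<and> completely_metrizable_space X"

definition borel_of :: "'a topology \<Rightarrow> 'a measure"
  where "borel_of X = sigma (topspace X) {U. openin X U}"

(* The generating sets below are closed under binary intersection, so they form a base of
   the topology they generate. *)
definition Fell_topology :: "'a topology \<Rightarrow> 'a set topology"
  where "Fell_topology X = topology_generated_by
    {{F. closedin X F \<and> F \<inter> K = {} \<and> (\<forall>U\<in>\<U>. F \<inter> U \<noteq> {})} | K \<U>.
       compactin X K \<and> finite \<U> \<and> (\<forall>U\<in>\<U>. openin X U)}"

(* A function is determined by its values on the carrier of X only if it has a fixed value
   elsewhere, hence the restriction to extensional functions. *)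
definition cont_maps :: "'a topology \<Rightarrow> 'b topology \<Rightarrow> ('a \<Rightarrow> 'b) set"
  where "cont_maps X Y = {f \<in> extensional (topspace X). continuous_map X Y f}"

definition compact_open_topology :: "'a topology \<Rightarrow> 'b topology \<Rightarrow> ('a \<Rightarrow> 'b) topology"
  where "compact_open_topology X Y = topology_generated_by
    {{f \<in> cont_maps X Y. f ` K \<subseteq> U} | K U. compactin X K \<and> openin Y U}"

definition disjoint_closed_pairs :: "'a topology \<Rightarrow> ('a set \<times> 'a set) set"
  where "disjoint_closed_pairs X = {(A, B). closedin X A \<and> closedin X B \<and> A \<inter> B = {}}"

lemma topspace_Fell_topology [simp]: "topspace (Fell_topology X) = {F. closedin X F}"
proof -
  have "{F. closedin X F} \<subseteq> topspace (Fell_topology X)"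
    unfolding Fell_topology_def topology_generated_by_topspace
    by (rule Union_upper, rule CollectI, rule exI[of _ "{}"], rule exI[of _ "{}"]) auto
  then show ?thesis
    by (auto simp: Fell_topology_def)
qed

lemma topspace_compact_open_topology [simp]:
  "topspace (compact_open_topology X Y) = cont_maps X Y"
proof -
  have "cont_maps X Y \<subseteq> topspace (compact_open_topology X Y)"
    unfolding compact_open_topology_def topology_generated_by_topspace
    by (rule Union_upper, rule CollectI, rule exI[of _ "{}"], rule exI[of _ "{}"]) auto
  then show ?thesis
    by (auto simp: compact_open_topology_def)
qed

end

theory Submission
  imports Defs
begin

text \<open>
  Fix a metric \<open>d\<close> on \<open>X\<close> and let \<open>d\<^sub>A\<close> be the distance to \<open>A\<close>, truncated at \<open>1\<close> so that it makes
  sense for \<open>A = {}\<close>. The Urysohn function \<open>d\<^sub>A / (d\<^sub>A + d\<^sub>B)\<close> depends measurably on \<open>(A, B)\<close>: the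
  condition \<open>d\<^sub>A x < r\<close> says that \<open>A\<close> meets a ball, which is open in the Fell topology, and the Borel
  sets of the compact-open topology on maps from a second countable space are generated by the
  evaluations at the points of a countable dense set. Local compactness enters in the
  measurability of the set of disjoint pairs: for compact \<open>L\<close> the condition \<open>A \<inter> B \<inter> L = {}\<close> is open,
  and \<open>X\<close> is a countable union of compact sets.
\<close>

section \<open>Countable bases in separable metric spaces\<close>

lemma (in Metric_space) separable_imp_second_countable:
  assumes "separable_space mtopology"
  shows "second_countable mtopology"
proof -
  obtain C where C: "countable C" "C \<subseteq> M" "mtopology closure_of C = M"
    using assms by (auto simp: separable_space_def)
  define \<B> where "\<B> = (\<lambda>(c, n). mball c (1 / real (Suc n))) ` (C \<times> UNIV)"
  have "countable \<B>"
    unfolding \<B>_def using C(1) by (intro countable_image countable_SIGMA) auto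
  moreover have "\<forall>V\<in>\<B>. openin mtopology V"
    by (auto simp: \<B>_def)
  moreover have "\<exists>V\<in>\<B>. x \<in> V \<and> V \<subseteq> U" if U: "openin mtopology U" "x \<in> U" for U x
  proof -
    obtain r where r: "r > 0" "mball x r \<subseteq> U" and x: "x \<in> M"
      using U unfolding openin_mtopology by blast
    \<comment> \<open>Half of \<open>r\<close>, because the radius is spent twice: on the distance
      from \<open>x\<close> to the centre \<open>c\<close> and on the distance from \<open>c\<close>
      to \<open>y\<close>.\<close>
    obtain n where n: "1 / real (Suc n) < r / 2"
      using r(1) nat_approx_posE[of "r / 2"] by auto
    have "x \<in> mtopology closure_of C" and "1 / real (Suc n) > 0"
      using C(3) x by simp_all
    then obtain c where c: "c \<in> C" "c \<in> mball x (1 / real (Suc n))"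
      unfolding metric_closure_of by blast
    have "mball c (1 / real (Suc n)) \<subseteq> mball x r"
    proof
      fix y assume y: "y \<in> mball c (1 / real (Suc n))"
      then have "d x y \<le> d x c + d c y"
        using c(2) by (intro triangle) auto
      also have "\<dots> < r"
        using y c(2) n unfolding in_mball by linarith
      finally show "y \<in> mball x r"
        using x y by simp
    qed
    then have "mball c (1 / real (Suc n)) \<subseteq> U"
      using r(2) by blast
    moreover have "x \<in> mball c (1 / real (Suc n))"
      using c(2) by (auto simp: commute)
    moreover have "mball c (1 / real (Suc n)) \<in> \<B>"
      unfolding \<B>_def using c(1) by (intro image_eqI[of _ _ "(c, n)"]) auto
    ultimately show ?thesis by blast
  qed
  ultimately show ?thesis
    unfolding second_countable_def by (intro exI[of _ \<B>] conjI allI impI) auto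
qed

section \<open>Truncated distance to a set and the Urysohn quotient\<close>

context Metric_space
begin

text \<open>The minimum of 1 and the usual distance to \<open>A\<close>. The inserted 1 keeps the
  infimum over a nonempty set, and the value for \<open>A = {}\<close> is 1.\<close>

definition capped_infdist :: "'a set \<Rightarrow> 'a \<Rightarrow> real"
  where "capped_infdist A x = Inf (insert 1 (d x ` A))"

lemma bdd_below_dist_image [simp]: "bdd_below (d x ` A)"
  by (rule bdd_belowI[of _ 0]) auto

text \<open>An infimum lies strictly below \<open>r\<close> only if some element does; the first
  disjunct comes from the inserted 1, the second will become a hit condition on \<open>A\<close> in
  the Fell topology.\<close>

lemma capped_infdist_less_iff:
  "capped_infdist A x < r \<longleftrightarrow> 1 < r \<or> (\<exists>a\<in>A. d x a < r)"
  unfolding capped_infdist_def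
  by (subst cInf_less_iff) auto

lemma capped_infdist_le_dist: "a \<in> A \<Longrightarrow> capped_infdist A x \<le> d x a"
  unfolding capped_infdist_def
  by (rule cInf_lower) auto

lemma capped_infdist_le_1: "capped_infdist A x \<le> 1"
  unfolding capped_infdist_def
  by (rule cInf_lower) auto

lemma capped_infdist_nonneg [simp]: "0 \<le> capped_infdist A x"
  using capped_infdist_less_iff[of A x 0] nonneg by (smt (verit))

lemma capped_infdist_self: "a \<in> A \<Longrightarrow> a \<in> M \<Longrightarrow> capped_infdist A a = 0"
  using capped_infdist_le_dist[of a A a] capped_infdist_nonneg[of A a] by simp

text \<open>Some ball of radius \<open>r\<close> around \<open>x\<close> misses \<open>A\<close>, so
  \<open>min r 1\<close> bounds from below both the distances to \<open>A\<close> and the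
  cap.\<close>

lemma capped_infdist_pos:
  assumes "closedin mtopology A" "x \<in> M" "x \<notin> A"
  shows "0 < capped_infdist A x"
proof -
  have "openin mtopology (M - A)"
    using assms(1) by (auto simp: closedin_def)
  then obtain r where r: "r > 0" "mball x r \<subseteq> M - A"
    using assms by (auto simp: openin_mtopology)
  have "A \<subseteq> M"
    using closedin_subset[OF assms(1)] by simp
  have far: "\<not> d x a < r" if "a \<in> A" for a
  proof
    assume "d x a < r"
    with that \<open>A \<subseteq> M\<close> assms(2) have "a \<in> mball x r" by auto
    with r(2) that show False by blast
  qed
  have "\<not> capped_infdist A x < min r 1"
  proof
    assume "capped_infdist A x < min r 1"
    then have "1 < min r 1 \<or> (\<exists>a\<in>A. d x a < min r 1)"
      by (rule capped_infdist_less_iff[THEN iffD1])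
    then show False
      using far by auto
  qed
  then show ?thesis
    using r(1) by linarith
qed

text \<open>Applied in both directions, this makes the capped distance 1-Lipschitz, which gives its
  continuity.\<close>

lemma capped_infdist_triangle:
  assumes "x \<in> M" "y \<in> M" "A \<subseteq> M"
  shows "capped_infdist A x \<le> d x y + capped_infdist A y"
proof -
  have "capped_infdist A x - d x y \<le> capped_infdist A y"
    unfolding capped_infdist_def[of A y]
  proof (rule cInf_greatest)
    fix z assume "z \<in> insert 1 (d y ` A)"
    then consider "z = 1" | a where "a \<in> A" "z = d y a" by blast
    then show "capped_infdist A x - d x y \<le> z"
    proof cases
      case 1
      then show ?thesis
        using capped_infdist_le_1[of A x] nonneg[of x y] by linarith
    next
      case 2
      then show ?thesis
        using capped_infdist_le_dist[of a A x] triangle[of x y a] assms by auto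
    qed
  qed simp
  then show ?thesis by simp
qed

lemma continuous_map_capped_infdist:
  assumes "A \<subseteq> M"
  shows "continuous_map mtopology euclideanreal (capped_infdist A)"
proof -
  have "\<exists>U. openin mtopology U \<and> x \<in> U \<and> (\<forall>y\<in>U. dist (capped_infdist A x) (capped_infdist A y) < e)"
    if "x \<in> M" "e > 0" for x e
  proof (intro exI conjI ballI)
    fix y assume "y \<in> mball x e"
    then show "dist (capped_infdist A x) (capped_infdist A y) < e"
      using capped_infdist_triangle[of x y A] capped_infdist_triangle[of y x A] assms
      by (auto simp: dist_real_def commute)
  qed (use that in auto)
  then show ?thesis
    using Met_TC.continuous_map_to_metric[of mtopology "capped_infdist A"] by auto
qed

lemma openin_Fell_capped_infdist_less:
  assumes "x \<in> M"
  shows "openin (Fell_topology mtopology) {A. closedin mtopology A \<and> capped_infdist A x < r}"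
proof (cases "1 < r")
  case True
  then show ?thesis
    \<comment> \<open>The cap alone makes the value less than \<open>r\<close>, so every closed set
      qualifies.\<close>
    using openin_topspace[of "Fell_topology mtopology"] by (simp add: capped_infdist_less_iff)
next
  case False
  \<comment> \<open>For \<open>r \<le> 1\<close> the condition says that \<open>A\<close> meets
    \<open>mball x r\<close>: a basic Fell set with empty compact part and a single open set to
    hit.\<close>
  have "{A. closedin mtopology A \<and> capped_infdist A x < r} =
    {A. closedin mtopology A \<and> A \<inter> {} = {} \<and> (\<forall>U\<in>{mball x r}. A \<inter> U \<noteq> {})}"
    using False assms closedin_subset[of mtopology] by (fastforce simp: capped_infdist_less_iff)
  also have "openin (Fell_topology mtopology) \<dots>"
    unfolding Fell_topology_def
    by (rule topology_generated_by_Basis, rule CollectI, rule exI[of _ "{}"],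
        rule exI[of _ "{mball x r}"]) auto
  finally show ?thesis .
qed

text \<open>The restriction to \<open>M\<close> makes the values extensional, as membership in
  \<open>cont_maps\<close> demands.\<close>

definition urysohn_quotient :: "'a set \<times> 'a set \<Rightarrow> 'a \<Rightarrow> real"
  where "urysohn_quotient = (\<lambda>(A, B). \<lambda>x\<in>M. capped_infdist A x / (capped_infdist A x + capped_infdist B x))"

text \<open>By disjointness \<open>x\<close> lies outside one of the two closed sets, and the
  distance to that one is positive.\<close>

lemma capped_infdist_sum_pos:
  assumes "(A, B) \<in> disjoint_closed_pairs mtopology" "x \<in> M"
  shows "0 < capped_infdist A x + capped_infdist B x"
proof -
  have "x \<notin> A \<or> x \<notin> B"
    using assms by (auto simp: disjoint_closed_pairs_def)
  then show ?thesis
    using assms capped_infdist_pos[of A x] capped_infdist_pos[of B x]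
    by (auto simp: disjoint_closed_pairs_def add_pos_nonneg add_nonneg_pos)
qed

lemma urysohn_quotient_in_cont_maps:
  assumes "(A, B) \<in> disjoint_closed_pairs mtopology"
  shows "urysohn_quotient (A, B) \<in> cont_maps mtopology (top_of_set {0..1})"
proof -
  have sub: "A \<subseteq> M" "B \<subseteq> M"
    using assms closedin_subset[of mtopology] by (auto simp: disjoint_closed_pairs_def)
  have pos: "0 < capped_infdist A x + capped_infdist B x" if "x \<in> M" for x
    using capped_infdist_sum_pos[OF assms that] .
  have "continuous_map mtopology euclideanreal
      (\<lambda>x. capped_infdist A x / (capped_infdist A x + capped_infdist B x))"
    using pos sub
    by (intro continuous_map_real_divide continuous_map_add continuous_map_capped_infdist)
      (auto simp: less_imp_neq[symmetric])
  then have "continuous_map mtopology euclideanreal (urysohn_quotient (A, B))"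
    by (rule continuous_map_eq) (auto simp: urysohn_quotient_def)
  moreover have "urysohn_quotient (A, B) \<in> M \<rightarrow> {0..1}"
    using pos by (auto simp: urysohn_quotient_def divide_simps)
  ultimately show ?thesis
    by (auto simp: cont_maps_def continuous_map_in_subtopology urysohn_quotient_def)
qed

lemma urysohn_quotient_eq_0: "x \<in> A \<Longrightarrow> x \<in> M \<Longrightarrow> urysohn_quotient (A, B) x = 0"
  by (simp add: urysohn_quotient_def capped_infdist_self)

text \<open>On \<open>B\<close> numerator and denominator coincide. Since \<open>0 / 0 = 0\<close>,
  their common value must be nonzero, and this is where disjointness enters.\<close>

lemma urysohn_quotient_eq_1:
  assumes "(A, B) \<in> disjoint_closed_pairs mtopology" "x \<in> B" "x \<in> M"
  shows "urysohn_quotient (A, B) x = 1"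
  using assms capped_infdist_sum_pos[OF assms(1,3)]
  by (simp add: urysohn_quotient_def capped_infdist_self)

end

section \<open>Borel sets, and measurability into a generated topology\<close>

lemma sets_borel_of: "sets (borel_of X) = sigma_sets (topspace X) {U. openin X U}"
  unfolding borel_of_def by (intro sets_measure_of) (auto dest: openin_subset)

lemma space_borel_of [simp]: "space (borel_of X) = topspace X"
  unfolding borel_of_def by (intro space_measure_of) (auto dest: openin_subset)

lemma openin_imp_sets_borel_of: "openin X U \<Longrightarrow> U \<in> sets (borel_of X)"
  by (auto simp: sets_borel_of)

lemma (in Metric_space) capped_infdist_measurable:
  assumes "x \<in> M"
  shows "(\<lambda>p. capped_infdist (fst p) x) \<in>
      borel_measurable (borel_of (prod_topology (Fell_topology mtopology) (Fell_topology mtopology)))"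
    and "(\<lambda>p. capped_infdist (snd p) x) \<in>
      borel_measurable (borel_of (prod_topology (Fell_topology mtopology) (Fell_topology mtopology)))"
proof -
  let ?F = "Fell_topology mtopology"
  let ?O = "\<lambda>r. {A. closedin mtopology A \<and> capped_infdist A x < r}"
  have F: "{p \<in> space (borel_of (prod_topology ?F ?F)). capped_infdist (fst p) x < r} = ?O r \<times> topspace ?F"
    and S: "{p \<in> space (borel_of (prod_topology ?F ?F)). capped_infdist (snd p) x < r} = topspace ?F \<times> ?O r"
    for r by auto
  have O: "openin ?F (?O r)" for r
    using assms by (rule openin_Fell_capped_infdist_less)
  have OF: "openin (prod_topology ?F ?F) (?O r \<times> topspace ?F)"
    and OS: "openin (prod_topology ?F ?F) (topspace ?F \<times> ?O r)" for r
    using O[of r] openin_topspace[of ?F] by (simp_all only: openin_prod_Times_iff simp_thms)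
  show "(\<lambda>p. capped_infdist (fst p) x) \<in> borel_measurable (borel_of (prod_topology ?F ?F))"
    unfolding borel_measurable_iff_less F by (intro allI openin_imp_sets_borel_of OF)
  show "(\<lambda>p. capped_infdist (snd p) x) \<in> borel_measurable (borel_of (prod_topology ?F ?F))"
    unfolding borel_measurable_iff_less S by (intro allI openin_imp_sets_borel_of OS)
qed

text \<open>
  The members of \<open>\<C>\<close> need not be open: every open set is a union of finite intersections of them, and
  there are only countably many such intersections.
\<close>

lemma measurable_borel_of_generated:
  assumes "countable \<C>"
    and sub: "\<And>S x. S \<in> \<S> \<Longrightarrow> x \<in> S \<Longrightarrow> \<exists>C\<in>\<C>. x \<in> C \<and> C \<subseteq> S"
    and g: "g \<in> space M \<rightarrow> \<Union>\<S>"
    and meas: "\<And>C. C \<in> \<C> \<Longrightarrow> g -` C \<inter> space M \<in> sets M"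
  shows "g \<in> M \<rightarrow>\<^sub>M borel_of (topology_generated_by \<S>)"
proof -
  define \<D> where "\<D> = Inter ` {F. F \<subseteq> \<C> \<and> finite F \<and> F \<noteq> {}}"
  have "countable {F. finite F \<and> F \<subseteq> \<C>}"
    using \<open>countable \<C>\<close> by (rule countable_Collect_finite_subset)
  then have "countable \<D>"
    unfolding \<D>_def by (intro countable_image) (rule countable_subset, auto)
  have inter: "D \<inter> E \<in> \<D>" if "D \<in> \<D>" "E \<in> \<D>" for D E
  proof -
    obtain F G where FG: "F \<subseteq> \<C>" "finite F" "F \<noteq> {}" "D = \<Inter>F" "G \<subseteq> \<C>" "finite G" "E = \<Inter>G"
      using \<open>D \<in> \<D>\<close> \<open>E \<in> \<D>\<close> by (auto simp: \<D>_def)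
    then have "D \<inter> E = \<Inter>(F \<union> G)" by auto
    then show ?thesis
      unfolding \<D>_def using FG by (intro image_eqI[of _ _ "F \<union> G"]) auto
  qed
  have single: "C \<in> \<D>" if "C \<in> \<C>" for C
    unfolding \<D>_def using that by (intro image_eqI[of _ _ "{C}"]) auto
  have base: "\<forall>x\<in>W. \<exists>D\<in>\<D>. x \<in> D \<and> D \<subseteq> W" if "generate_topology_on \<S> W" for W
    using that
  proof induction
    case (Int a b)
    show ?case
    proof
      fix x assume "x \<in> a \<inter> b"
      then obtain D E where "D \<in> \<D>" "x \<in> D" "D \<subseteq> a" "E \<in> \<D>" "x \<in> E" "E \<subseteq> b"
        using Int.IH by (metis IntE)
      then show "\<exists>D\<in>\<D>. x \<in> D \<and> D \<subseteq> a \<inter> b"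
        using inter by (intro bexI[of _ "D \<inter> E"]) auto
    qed
  next
    case (UN K)
    then show ?case by (meson Union_iff Union_upper order_trans)
  next
    case (Basis s)
    then show ?case using sub single by meson
  qed simp
  have measD: "g -` D \<inter> space M \<in> sets M" if "D \<in> \<D>" for D
  proof -
    obtain F where F: "F \<subseteq> \<C>" "finite F" "F \<noteq> {}" "D = \<Inter>F"
      using \<open>D \<in> \<D>\<close> by (auto simp: \<D>_def)
    then have "g -` D \<inter> space M = (\<Inter>C\<in>F. g -` C \<inter> space M)" by auto
    also have "\<dots> \<in> sets M"
      using F meas by (intro sets.finite_INT) auto
    finally show ?thesis .
  qed
  show ?thesis
    unfolding borel_of_def
  proof (rule measurable_measure_of)
    show "{U. openin (topology_generated_by \<S>) U} \<subseteq> Pow (topspace (topology_generated_by \<S>))"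
      using openin_subset by blast
    show "g \<in> space M \<rightarrow> topspace (topology_generated_by \<S>)"
      using g by simp
    fix W assume "W \<in> {U. openin (topology_generated_by \<S>) U}"
    then have "generate_topology_on \<S> W"
      by (simp add: openin_topology_generated_by_iff)
    then have "W = \<Union>{D \<in> \<D>. D \<subseteq> W}"
      using base[of W] by blast
    then have "g -` W \<inter> space M = (\<Union>D\<in>{D \<in> \<D>. D \<subseteq> W}. g -` D \<inter> space M)"
      by blast
    also have "\<dots> \<in> sets M"
      using \<open>countable \<D>\<close> measD by (intro sets.countable_UN') (auto intro: countable_subset)
    finally show "g -` W \<inter> space M \<in> sets M" .
  qed
qed

lemma compactin_finite_base_cover:
  assumes K: "compactin X K" "K \<subseteq> U" "openin X U"
    and "\<And>V. V \<in> \<B> \<Longrightarrow> openin X V"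
    and base: "\<And>x. x \<in> U \<Longrightarrow> \<exists>V\<in>\<B>. x \<in> V \<and> P V \<and> V \<subseteq> U"
  obtains F where "finite F" "F \<subseteq> \<B>" "\<And>V. V \<in> F \<Longrightarrow> P V \<and> V \<subseteq> U" "K \<subseteq> \<Union>F"
proof -
  have "K \<subseteq> \<Union>{V \<in> \<B>. P V \<and> V \<subseteq> U}"
    using base \<open>K \<subseteq> U\<close> by blast
  then obtain F where "finite F" "F \<subseteq> {V \<in> \<B>. P V \<and> V \<subseteq> U}" "K \<subseteq> \<Union>F"
    using compactinD[OF K(1), of "{V \<in> \<B>. P V \<and> V \<subseteq> U}"] assms(4) by auto
  then show thesis
    by (intro that[of F]) auto
qed

lemma continuous_map_into_closed_iff_dense:
  fixes f :: "'a \<Rightarrow> 'b::topological_space"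
  assumes f: "continuous_map X (top_of_set S) f" and "closed C" "openin X G"
    and Q: "X closure_of Q = topspace X"
  shows "f ` G \<subseteq> C \<longleftrightarrow> f ` (Q \<inter> G) \<subseteq> C"
proof
  assume QG: "f ` (Q \<inter> G) \<subseteq> C"
  have "continuous_map X euclidean f"
    using f by (simp add: continuous_map_in_subtopology)
  then have "openin X {x \<in> topspace X. f x \<in> - C}"
    using \<open>closed C\<close> by (intro openin_continuous_map_preimage) auto
  then have "openin X (G \<inter> {x \<in> topspace X. f x \<in> - C})"
    using \<open>openin X G\<close> by blast
  then have "G \<inter> {x \<in> topspace X. f x \<in> - C} = {}"
    using Q QG unfolding dense_intersects_open by blast
  then show "f ` G \<subseteq> C"
    using openin_subset[OF \<open>openin X G\<close>] by auto
qed auto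

proposition measurable_compact_open_evaluations:
  fixes S :: "real set"
  assumes "second_countable X"
    and Q: "countable Q" "Q \<subseteq> topspace X" "X closure_of Q = topspace X"
    and g: "g \<in> space M \<rightarrow> cont_maps X (top_of_set S)"
    and ev: "\<And>x. x \<in> Q \<Longrightarrow> (\<lambda>p. g p x) \<in> borel_measurable M"
  shows "g \<in> M \<rightarrow>\<^sub>M borel_of (compact_open_topology X (top_of_set S))"
proof -
  obtain \<B> where \<B>: "countable \<B>" "\<And>V. V \<in> \<B> \<Longrightarrow> openin X V"
      "\<And>U x. openin X U \<Longrightarrow> x \<in> U \<Longrightarrow> \<exists>V\<in>\<B>. x \<in> V \<and> V \<subseteq> U"
    using assms(1) unfolding second_countable_def by metis
  obtain \<R> :: "real set set" where \<R>: "countable \<R>" "\<And>V. V \<in> \<R> \<Longrightarrow> open V"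
      "\<And>U. open U \<Longrightarrow> \<exists>\<R>'\<subseteq>\<R>. U = \<Union>\<R>'"
    using univ_second_countable by metis
  define E where "E = (\<lambda>(F, H). {f \<in> cont_maps X (top_of_set S). f ` (Q \<inter> \<Union>F) \<subseteq> closure (\<Union>H)})"
  define \<C> where "\<C> = E ` ({F. finite F \<and> F \<subseteq> \<B>} \<times> {H. finite H \<and> H \<subseteq> \<R>})"
  show ?thesis
    unfolding compact_open_topology_def
  proof (rule measurable_borel_of_generated)
    show "countable \<C>"
      unfolding \<C>_def using \<B>(1) \<R>(1)
      by (intro countable_image countable_SIGMA countable_Collect_finite_subset)
    show "\<exists>C\<in>\<C>. f \<in> C \<and> C \<subseteq> A"
      if A: "A \<in> {{f \<in> cont_maps X (top_of_set S). f ` K \<subseteq> U} |K U.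
          compactin X K \<and> openin (top_of_set S) U}" and f: "f \<in> A" for A f
    proof -
      obtain K U where K: "compactin X K" and U: "openin (top_of_set S) U"
        and A_eq: "A = {f \<in> cont_maps X (top_of_set S). f ` K \<subseteq> U}"
        using A by blast
      obtain T where T: "open T" "U = S \<inter> T"
        using U by (auto simp: openin_open)
      have fc: "continuous_map X (top_of_set S) f" and fK: "f ` K \<subseteq> T"
        using f T by (auto simp: A_eq cont_maps_def)
      have fc': "continuous_map X euclidean f"
        using fc by (simp add: continuous_map_in_subtopology)
      have fine: "\<exists>V\<in>\<R>. y \<in> V \<and> closure V \<subseteq> T \<and> V \<subseteq> T" if y: "y \<in> T" for y
      proof -
        obtain e where e: "e > 0" "cball y e \<subseteq> T"
          using T(1) y open_contains_cball by blast
        obtain V where V: "V \<in> \<R>" "y \<in> V" "V \<subseteq> ball y e"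
          using \<R>(3)[of "ball y e"] e(1) by (metis Union_iff Sup_upper centre_in_ball open_ball subset_iff)
        have "closure V \<subseteq> cball y e"
          using V(3) by (intro closure_minimal) auto
        then show ?thesis
          using V e(2) closure_subset[of V] by blast
      qed
      obtain H where H: "finite H" "H \<subseteq> \<R>" "\<And>V. V \<in> H \<Longrightarrow> closure V \<subseteq> T \<and> V \<subseteq> T" "f ` K \<subseteq> \<Union>H"
        by (rule compactin_finite_base_cover[OF image_compactin[OF K fc'] fK _ _ fine])
          (simp_all add: T(1) \<R>(2))
      have "open (\<Union>H)"
        using H(2) \<R>(2) by blast
      then have op: "openin X {x \<in> topspace X. f x \<in> \<Union>H}"
        using openin_continuous_map_preimage[OF fc', of "\<Union>H"] by (simp only: open_openin)
      have KH: "K \<subseteq> {x \<in> topspace X. f x \<in> \<Union>H}"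
        using H(4) compactin_subset_topspace[OF K] by auto
      obtain F where F: "finite F" "F \<subseteq> \<B>" "\<And>V. V \<in> F \<Longrightarrow> V \<subseteq> {x \<in> topspace X. f x \<in> \<Union>H}" "K \<subseteq> \<Union>F"
        by (rule compactin_finite_base_cover[OF K KH op, of \<B> "\<lambda>_. True"])
          (simp_all only: \<B>(2,3) op simp_thms)
      have "f ` (Q \<inter> \<Union>F) \<subseteq> closure (\<Union>H)"
        using F(3) closure_subset[of "\<Union>H"] by blast
      then have "f \<in> E (F, H)"
        using f by (auto simp: E_def A_eq)
      moreover have "E (F, H) \<subseteq> A"
      proof
        fix h assume h: "h \<in> E (F, H)"
        then have hc: "continuous_map X (top_of_set S) h" and hE: "h \<in> cont_maps X (top_of_set S)"
          by (auto simp: E_def cont_maps_def)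
        have "openin X (\<Union>F)"
          using F(2) \<B>(2) by blast
        then have "h ` \<Union>F \<subseteq> closure (\<Union>H)"
          using continuous_map_into_closed_iff_dense[OF hc _ _ Q(3)] h by (simp add: E_def)
        also have "\<dots> \<subseteq> (\<Union>V\<in>H. closure V)"
          using H(1) closure_subset by (intro closure_minimal closed_UN) auto
        also have "\<dots> \<subseteq> T"
          using H(3) by blast
        finally have "h ` K \<subseteq> T"
          using F(4) by blast
        moreover have "h ` K \<subseteq> S"
          using hc compactin_subset_topspace[OF K] by (auto simp: continuous_map_in_subtopology)
        ultimately show "h \<in> A"
          using hE T(2) by (auto simp: A_eq)
      qed
      moreover have "E (F, H) \<in> \<C>"
        unfolding \<C>_def using F(1,2) H(1,2) by blast
      ultimately show ?thesis by blast
    qed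
    show "g \<in> space M \<rightarrow> \<Union>{{f \<in> cont_maps X (top_of_set S). f ` K \<subseteq> U} |K U.
          compactin X K \<and> openin (top_of_set S) U}"
      using g topspace_compact_open_topology[of X "top_of_set S"]
      unfolding compact_open_topology_def by simp
    show "g -` C \<inter> space M \<in> sets M" if "C \<in> \<C>" for C
    proof -
      obtain F H where C: "C = {f \<in> cont_maps X (top_of_set S). f ` (Q \<inter> \<Union>F) \<subseteq> closure (\<Union>H)}"
        using \<open>C \<in> \<C>\<close> by (auto simp: \<C>_def E_def)
      have "g -` C \<inter> space M = {p \<in> space M. \<forall>x\<in>Q \<inter> \<Union>F. g p x \<in> closure (\<Union>H)}"
        using g by (auto simp: C)
      also have "\<dots> \<in> sets M"
      proof (rule sets.sets_Collect_countable_All')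
        show "countable (Q \<inter> \<Union>F)"
          using Q(1) by blast
        fix x assume "x \<in> Q \<inter> \<Union>F"
        then have "(\<lambda>p. g p x) -` closure (\<Union>H) \<inter> space M \<in> sets M"
          using ev by (intro measurable_sets[of _ _ borel]) auto
        also have "(\<lambda>p. g p x) -` closure (\<Union>H) \<inter> space M = {p \<in> space M. g p x \<in> closure (\<Union>H)}"
          by auto
        finally show "{p \<in> space M. g p x \<in> closure (\<Union>H)} \<in> sets M" .
      qed
      finally show ?thesis .
    qed
  qed
qed

lemma openin_Fell_miss:
  assumes "compactin X K"
  shows "openin (Fell_topology X) {F. closedin X F \<and> F \<inter> K = {}}"
proof -
  have "openin (Fell_topology X) {F. closedin X F \<and> F \<inter> K = {} \<and> (\<forall>U\<in>{}. F \<inter> U \<noteq> {})}"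
    unfolding Fell_topology_def
    by (rule topology_generated_by_Basis, rule CollectI, rule exI[of _ K], rule exI[of _ "{}"])
      (use assms in auto)
  then show ?thesis by simp
qed

lemma openin_Fell_disjoint_on_compact:
  assumes X: "Hausdorff_space X" "locally_compact_space X" and L: "compactin X L"
  shows "openin (prod_topology (Fell_topology X) (Fell_topology X))
    {(A, B). closedin X A \<and> closedin X B \<and> A \<inter> B \<inter> L = {}}"
proof (subst openin_prod_topology_alt, intro allI impI)
  fix A B assume "(A, B) \<in> {(A, B). closedin X A \<and> closedin X B \<and> A \<inter> B \<inter> L = {}}"
  then have AB: "closedin X A" "closedin X B" "A \<inter> B \<inter> L = {}" by auto
  have AL: "compactin X (A \<inter> L)"
    using AB(1) L by (rule closed_Int_compactin)
  have op: "openin X (topspace X - B)" and ALB: "A \<inter> L \<subseteq> topspace X - B"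
    using AB compactin_subset_topspace[OF L] by auto
  have "neighbourhood_base_of (compactin X) X"
    using X locally_compact_space_neighbourhood_base by blast
  then have nb: "\<exists>V\<in>{V. openin X V}. x \<in> V \<and> (\<exists>N. compactin X N \<and> V \<subseteq> N \<and> N \<subseteq> topspace X - B) \<and>
      V \<subseteq> topspace X - B" if x: "x \<in> topspace X - B" for x
  proof -
    assume "neighbourhood_base_of (compactin X) X"
    then obtain V N where "openin X V" "compactin X N" "x \<in> V" "V \<subseteq> N" "N \<subseteq> topspace X - B"
      using op x unfolding neighbourhood_base_of by meson
    then show ?thesis
      by (intro bexI[of _ V]) auto
  qed
  obtain F where F: "finite F" "F \<subseteq> {V. openin X V}" "A \<inter> L \<subseteq> \<Union>F"
    "\<And>V. V \<in> F \<Longrightarrow> (\<exists>N. compactin X N \<and> V \<subseteq> N \<and> N \<subseteq> topspace X - B) \<and> V \<subseteq> topspace X - B"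
    by (rule compactin_finite_base_cover[OF AL ALB op _ nb]) auto
  then obtain N where N: "\<And>V. V \<in> F \<Longrightarrow> compactin X (N V) \<and> V \<subseteq> N V \<and> N V \<subseteq> topspace X - B"
    by metis
  define K where "K = (\<Union>V\<in>F. N V)"
  have K: "compactin X K" "K \<inter> B = {}" "\<Union>F \<subseteq> K"
    using N F(1) by (auto simp: K_def intro!: compactin_Union)
  have "closedin X (topspace X - \<Union>F)"
    using F(2) by blast
  then have "compactin X (L \<inter> (topspace X - \<Union>F))"
    using L by (intro compact_Int_closedin)
  then have K': "compactin X (L - \<Union>F)"
    using compactin_subset_topspace[OF L] by (simp add: Int_Diff[symmetric] inf.absorb1)
  show "\<exists>U V. openin (Fell_topology X) U \<and> openin (Fell_topology X) V \<and> A \<in> U \<and> B \<in> V \<and>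
      U \<times> V \<subseteq> {(A, B). closedin X A \<and> closedin X B \<and> A \<inter> B \<inter> L = {}}"
  proof (intro exI conjI)
    show "openin (Fell_topology X) {A. closedin X A \<and> A \<inter> (L - \<Union>F) = {}}"
      using K' by (rule openin_Fell_miss)
    show "openin (Fell_topology X) {B. closedin X B \<and> B \<inter> K = {}}"
      using K(1) by (rule openin_Fell_miss)
    show "{A. closedin X A \<and> A \<inter> (L - \<Union>F) = {}} \<times> {B. closedin X B \<and> B \<inter> K = {}} \<subseteq>
        {(A, B). closedin X A \<and> closedin X B \<and> A \<inter> B \<inter> L = {}}"
      using K(3) by fast
  qed (use AB F(3) K(2) in auto)
qed

lemma sigma_compactI:
  assumes "second_countable X" "locally_compact_space X"
  obtains \<L> where "countable \<L>" "\<And>L. L \<in> \<L> \<Longrightarrow> compactin X L" "\<Union>\<L> = topspace X"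
proof -
  let ?\<U> = "{U. openin X U \<and> (\<exists>L. compactin X L \<and> U \<subseteq> L)}"
  have "\<Union>?\<U> = topspace X"
  proof
    show "\<Union>?\<U> \<subseteq> topspace X"
      by (auto dest: openin_subset)
    show "topspace X \<subseteq> \<Union>?\<U>"
    proof
      fix x assume "x \<in> topspace X"
      then obtain U L where "openin X U" "compactin X L" "x \<in> U" "U \<subseteq> L"
        using assms(2) unfolding locally_compact_space_def by blast
      then show "x \<in> \<Union>?\<U>" by (intro UnionI[of U]) auto
    qed
  qed
  moreover have "Lindelof_space X"
    using assms(1) by (rule second_countable_imp_Lindelof_space)
  ultimately have "\<exists>\<V>. countable \<V> \<and> \<V> \<subseteq> ?\<U> \<and> \<Union>\<V> = topspace X"
    by (intro Lindelof_spaceD) simp_all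
  then obtain \<V> where \<V>: "countable \<V>" "\<V> \<subseteq> ?\<U>" "\<Union>\<V> = topspace X"
    by (elim exE conjE)
  then have "\<forall>V\<in>\<V>. \<exists>L. compactin X L \<and> V \<subseteq> L" by blast
  then obtain L where L: "\<forall>V\<in>\<V>. compactin X (L V) \<and> V \<subseteq> L V"
    by (rule bchoice[THEN exE])
  show thesis
  proof (rule that[of "L ` \<V>"])
    show "\<Union>(L ` \<V>) = topspace X"
    proof
      show "\<Union>(L ` \<V>) \<subseteq> topspace X"
        using L by (intro UN_least compactin_subset_topspace) simp
      show "topspace X \<subseteq> \<Union>(L ` \<V>)"
        unfolding \<V>(3)[symmetric] using L by (intro Union_least) blast
    qed
  qed (use \<V>(1) L in auto)
qed

proposition disjoint_closed_pairs_Borel: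
  assumes X: "Hausdorff_space X" "second_countable X" "locally_compact_space X"
  shows "disjoint_closed_pairs X \<in> sets (borel_of (prod_topology (Fell_topology X) (Fell_topology X)))"
proof -
  obtain \<L> where \<L>: "countable \<L>" "\<And>L. L \<in> \<L> \<Longrightarrow> compactin X L" "\<Union>\<L> = topspace X"
    using sigma_compactI[OF X(2,3)] by metis
  let ?P = "\<lambda>L. {(A, B). closedin X A \<and> closedin X B \<and> A \<inter> B \<inter> L = {}}"
  have "A \<inter> B = {}" if "closedin X A" "\<forall>L\<in>insert {} \<L>. A \<inter> B \<inter> L = {}" for A B
    using that \<L>(3) closedin_subset[of X A] by blast
  then have "disjoint_closed_pairs X = (\<Inter>L\<in>insert {} \<L>. ?P L)"
    by (auto simp: disjoint_closed_pairs_def)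
  also have "\<dots> \<in> sets (borel_of (prod_topology (Fell_topology X) (Fell_topology X)))"
  proof (rule sets.countable_INT')
    have "compactin X L" if "L \<in> insert {} \<L>" for L
      using that \<L>(2) by auto
    then show "?P ` insert {} \<L> \<subseteq> sets (borel_of (prod_topology (Fell_topology X) (Fell_topology X)))"
      using X(1,3)
      by (intro image_subsetI openin_imp_sets_borel_of openin_Fell_disjoint_on_compact)
  qed (use \<L>(1) in auto)
  finally show ?thesis .
qed

proposition (in Metric_space) urysohn_quotient_measurable:
  assumes "separable_space mtopology"
  shows "urysohn_quotient \<in>
    restrict_space (borel_of (prod_topology (Fell_topology mtopology) (Fell_topology mtopology)))
      (disjoint_closed_pairs mtopology)
    \<rightarrow>\<^sub>M borel_of (compact_open_topology mtopology (top_of_set {0..1}))"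
proof -
  obtain Q where Q: "countable Q" "Q \<subseteq> topspace mtopology" "mtopology closure_of Q = topspace mtopology"
    using assms by (auto simp: separable_space_def)
  show ?thesis
  proof (rule measurable_compact_open_evaluations[OF separable_imp_second_countable[OF assms] Q])
    fix x assume "x \<in> Q"
    then have x: "x \<in> M"
      using Q(2) by auto
    have "(\<lambda>p. urysohn_quotient p x) =
        (\<lambda>p. capped_infdist (fst p) x / (capped_infdist (fst p) x + capped_infdist (snd p) x))"
      using x by (auto simp: urysohn_quotient_def)
    then show "(\<lambda>p. urysohn_quotient p x) \<in> borel_measurable
        (restrict_space (borel_of (prod_topology (Fell_topology mtopology) (Fell_topology mtopology)))
          (disjoint_closed_pairs mtopology))"
      using capped_infdist_measurable[OF x]
      by (auto intro!: measurable_restrict_space1 borel_measurable_divide borel_measurable_add)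
  qed (auto simp: space_restrict_space urysohn_quotient_in_cont_maps)
qed

theorem lemma6p3:
  fixes X :: "'a topology"
  assumes "Polish_space X" and "locally_compact_space X"
  shows "disjoint_closed_pairs X
           \<in> sets (borel_of (prod_topology (Fell_topology X) (Fell_topology X))) \<and>
         (\<forall>(A, B) \<in> disjoint_closed_pairs X.
            \<exists>f. continuous_map X (top_of_set {0..1::real}) f \<and>
                (\<forall>x\<in>A. f x = 0) \<and> (\<forall>x\<in>B. f x = 1)) \<and>
         (\<exists>\<Phi> \<in> restrict_space (borel_of (prod_topology (Fell_topology X) (Fell_topology X)))
                  (disjoint_closed_pairs X)
                \<rightarrow>\<^sub>M borel_of (compact_open_topology X (top_of_set {0..1::real})).
            \<forall>(A, B) \<in> disjoint_closed_pairs X.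
              (\<forall>x\<in>A. \<Phi> (A, B) x = 0) \<and> (\<forall>x\<in>B. \<Phi> (A, B) x = 1))"
proof -
  have "metrizable_space X"
    using assms(1) by (simp add: Polish_space_def completely_metrizable_imp_metrizable_space)
  then obtain M d where "Metric_space M d" and X: "X = Metric_space.mtopology M d"
    by (auto simp: metrizable_space_def)
  interpret Metric_space M d by fact
  have sep: "separable_space mtopology"
    using assms(1) by (simp add: Polish_space_def X)
  have eq: "(\<forall>x\<in>A. urysohn_quotient (A, B) x = 0) \<and> (\<forall>x\<in>B. urysohn_quotient (A, B) x = 1)"
    if "(A, B) \<in> disjoint_closed_pairs X" for A B
  proof -
    have "A \<subseteq> M" "B \<subseteq> M"
      using that closedin_subset[of mtopology] by (auto simp: X disjoint_closed_pairs_def)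
    then show ?thesis
      using that urysohn_quotient_eq_0[of _ A B] urysohn_quotient_eq_1[of A B] by (auto simp: X)
  qed
  show ?thesis
  proof (intro conjI)
    show "disjoint_closed_pairs X
        \<in> sets (borel_of (prod_topology (Fell_topology X) (Fell_topology X)))"
      using \<open>metrizable_space X\<close> assms(2) separable_imp_second_countable[OF sep]
      by (simp add: X disjoint_closed_pairs_Borel metrizable_imp_Hausdorff_space)
    show "\<forall>(A, B) \<in> disjoint_closed_pairs X.
        \<exists>f. continuous_map X (top_of_set {0..1::real}) f \<and> (\<forall>x\<in>A. f x = 0) \<and> (\<forall>x\<in>B. f x = 1)"
    proof safe
      fix A B assume "(A, B) \<in> disjoint_closed_pairs X"
      with eq[of A B] urysohn_quotient_in_cont_maps[of A B]
      show "\<exists>f. continuous_map X (top_of_set {0..1::real}) f \<and> (\<forall>x\<in>A. f x = 0) \<and> (\<forall>x\<in>B. f x = 1)"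
        by (intro exI[of _ "urysohn_quotient (A, B)"]) (simp add: X cont_maps_def)
    qed
    show "\<exists>\<Phi> \<in> restrict_space (borel_of (prod_topology (Fell_topology X) (Fell_topology X)))
          (disjoint_closed_pairs X)
        \<rightarrow>\<^sub>M borel_of (compact_open_topology X (top_of_set {0..1::real})).
        \<forall>(A, B) \<in> disjoint_closed_pairs X.
          (\<forall>x\<in>A. \<Phi> (A, B) x = 0) \<and> (\<forall>x\<in>B. \<Phi> (A, B) x = 1)"
      using eq urysohn_quotient_measurable[OF sep]
      by (intro bexI[of _ urysohn_quotient] ballI) (auto simp only: X)
  qed
qed

end
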